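(* Let $I[C_i][H_i][W_i]$ be a feature map array and $W[C_o][C_i][K][K]$ a kernel array, with $H_i=H_o+K-1$ and $W_i=W_o+K-1$, and let $O[C_o][H_o][W_o]$ be the output feature map array of the DNN convolution, $$O[c_o][h][w]=\sum_{c_i=0}^{C_i-1}\sum_{k_h=0}^{K-1}\sum_{k_w=0}^{K-1} I[c_i][h+k_h][w+k_w]\,W[c_o][c_i][k_h][k_w].$$ Then the output feature map can be computed using the 1-D convolution $F_{X\cdot N,K}$ by $$O[c_o][h][w]=\sum_{c_i=0}^{C_i-1}\sum_{k_h=0}^{K-1} y_{c_i,c_o,h,k_h}[w+K-1],$$ where $y_{c_i,c_o,h,k_h}$ is the 1-D convolution result, with $X=\lceil W_i/N\rceil-1$, $$y_{c_i,c_o,h,k_h}=F_{X\cdot N,K}(f,g),$$ and $f$ and $g$ are defined by $$f[w]=\begin{cases} I[c_i][h+k_h][w], & 0\le h<H_i,\ 0\le w<W_i,\\ 0, & \text{otherwise,}\end{cases}\qquad g=W[c_o][c_i][k_h][K-1:0],$$ i.e. $g[k]=W[c_o][c_i][k_h][K-1-k]$ for $0\le k<K$.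
   Context: All arrays are indexed from $0$; the notation $I[C_i][H_i][W_i]$ gives the dimensions of the array (input channels, height, width), $W[C_o][C_i][K][K]$ has output channels, input channels, kernel height and kernel width, and $O[C_o][H_o][W_o]$ has output channels, height and width. The index ranges are $0\le c_i<C_i$, $0\le c_o<C_o$, $0\le h<H_o$, $0\le w<W_o$, $0\le k_h<K$. $N$ is the length of the sequences handled by the base operation $F_{N,K}$. For positive integers $L,K$, $F_{L,K}(f,g)$ denotes the 1-D discrete convolution between an $L$-element sequence $f$ and a $K$-element kernel $g$: $F_{L,K}(f,g)[m]=\sum_{k=0}^{K-1}\tilde f[m-k]\,g[k]$, where $\tilde f[n]=f[n]$ for $0\le n<L$ and $\tilde f[n]=0$ for $n<0$ or $n\ge L$.
   Formalization: The formal statement takes X = ⌈W_i/N⌉ instead of X = ⌈W_i/N⌉ − 1; with the latter X·N < W_i cuts off the end of each row and the identity fails, e.g. for N = K = 1, W_i = 2 and all entries 1. *)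

theory Defs
  imports Complex_Main
begin

text \<open>Arrays are functions of their natural-number indices; only the values at indices
  within the stated dimensions are ever used.\<close>

definition zero_ext :: "nat \<Rightarrow> (nat \<Rightarrow> 'a::zero) \<Rightarrow> int \<Rightarrow> 'a" where
  "zero_ext L f n = (if 0 \<le> n \<and> n < int L then f (nat n) else 0)"

text \<open>The 1-D convolution of an \<open>L\<close>-element sequence with a \<open>K\<close>-element kernel. The index
  \<open>m - k\<close> may be negative, so it is taken in the integers.\<close>

definition conv1d :: "nat \<Rightarrow> nat \<Rightarrow> (nat \<Rightarrow> 'a::comm_semiring_1) \<Rightarrow> (nat \<Rightarrow> 'a) \<Rightarrow> nat \<Rightarrow> 'a" where
  "conv1d L K f g m = (\<Sum>k<K. zero_ext L f (int m - int k) * g k)"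

definition dnn_conv ::
  "nat \<Rightarrow> nat \<Rightarrow> (nat \<Rightarrow> nat \<Rightarrow> nat \<Rightarrow> 'a::comm_semiring_1) \<Rightarrow>
   (nat \<Rightarrow> nat \<Rightarrow> nat \<Rightarrow> nat \<Rightarrow> 'a) \<Rightarrow> nat \<Rightarrow> nat \<Rightarrow> nat \<Rightarrow> 'a" where
  "dnn_conv Ci K I W co h w =
     (\<Sum>ci<Ci. \<Sum>kh<K. \<Sum>kw<K. I ci (h + kh) (w + kw) * W co ci kh kw)"

definition fm_row ::
  "nat \<Rightarrow> nat \<Rightarrow> (nat \<Rightarrow> nat \<Rightarrow> nat \<Rightarrow> 'a::comm_semiring_1) \<Rightarrow>
   nat \<Rightarrow> nat \<Rightarrow> nat \<Rightarrow> nat \<Rightarrow> 'a" where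
  "fm_row Hi Wi I ci h kh w = (if h < Hi \<and> w < Wi then I ci (h + kh) w else 0)"

text \<open>The reversed kernel row; meaningful for \<open>k < K\<close>.\<close>

definition rev_kernel_row ::
  "nat \<Rightarrow> (nat \<Rightarrow> nat \<Rightarrow> nat \<Rightarrow> nat \<Rightarrow> 'a::comm_semiring_1) \<Rightarrow>
   nat \<Rightarrow> nat \<Rightarrow> nat \<Rightarrow> nat \<Rightarrow> 'a" where
  "rev_kernel_row K W co ci kh k = W co ci kh (K - 1 - k)"

text \<open>A row of \<open>Wi\<close> elements is convolved as a sequence of \<open>X * N\<close> elements, where
  \<open>X = \<lceil>Wi / N\<rceil>\<close> is the least \<open>X\<close> with \<open>Wi \<le> X * N\<close>. The value \<open>\<lceil>Wi / N\<rceil> - 1\<close>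
  would give \<open>X * N < Wi\<close> and cut off the end of the row: for \<open>N = K = 1\<close> and
  \<open>Wi = 2\<close> the last output would always come out as \<open>0\<close>.\<close>

end

theory Submission
  imports Defs
begin

text \<open>Convolving with a reversed kernel is correlating with the kernel itself: at position
  \<open>w + K - 1\<close>, the tap \<open>K - 1 - k\<close> of the reversed kernel meets the entry
  \<open>w + k\<close> of the sequence. This is \<open>conv1d_reversed_eq_correlation\<close>, valid
  as long as the window of K entries starting at w lies inside the sequence. Each inner sum over
  \<open>kw\<close> in \<open>dnn_conv\<close> is such a correlation along one row of the feature
  map, and summing over \<open>ci\<close> and \<open>kh\<close> gives the output. That the window
  fits rests on \<lceil>Wi / N\<rceil> * N \<ge> Wi, which is
  \<open>le_nat_ceiling_divide_mult\<close>.\<close>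

lemma conv1d_reversed_eq_correlation:
  assumes "w + K \<le> L"
  shows "conv1d L K f (\<lambda>k. g (K - 1 - k)) (w + K - 1) = (\<Sum>k<K. f (w + k) * g k)"
proof -
  have "zero_ext L f (int (w + K - 1) - int k) * g (K - 1 - k)
      = f (w + (K - Suc k)) * g (K - Suc k)" if "k < K" for k
  proof -
    \<comment> \<open>The shift by K - 1 keeps every index nonnegative for k < K; with the upper
      bound below, \<open>zero_ext\<close> never returns its default 0.\<close>
    have "int (w + K - 1) - int k = int (w + (K - Suc k))"
      using that by linarith
    moreover have "w + (K - Suc k) < L"
      using assms that by linarith
    ultimately show ?thesis
      by (simp add: zero_ext_def nat_int_add)
  qed
  then have "conv1d L K f (\<lambda>k. g (K - 1 - k)) (w + K - 1)
      = (\<Sum>k<K. f (w + (K - Suc k)) * g (K - Suc k))"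
    unfolding conv1d_def by (intro sum.cong) auto
  \<comment> \<open>The substitution k \<mapsto> K - 1 - k permutes the indices below K and undoes
    the reversal.\<close>
  also have "\<dots> = (\<Sum>k<K. f (w + k) * g k)"
    by (rule sum.nat_diff_reindex)
  finally show ?thesis .
qed

lemma le_nat_ceiling_divide_mult:
  fixes m n :: nat
  assumes "n > 0"
  shows "m \<le> nat \<lceil>real m / real n\<rceil> * n"
proof -
  have "real m / real n \<le> real (nat \<lceil>real m / real n\<rceil>)"
    by (rule of_nat_ceiling)
  then have "real m \<le> real (nat \<lceil>real m / real n\<rceil> * n)"
    using assms by (simp only: pos_divide_le_eq of_nat_0_less_iff of_nat_mult)
  then show ?thesis
    by (simp only: of_nat_le_iff)
qed

theorem theorem3:
  fixes I :: "nat \<Rightarrow> nat \<Rightarrow> nat \<Rightarrow> 'a::comm_semiring_1"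
    and W :: "nat \<Rightarrow> nat \<Rightarrow> nat \<Rightarrow> nat \<Rightarrow> 'a"
    and Out :: "nat \<Rightarrow> nat \<Rightarrow> nat \<Rightarrow> 'a"
    and y :: "nat \<Rightarrow> nat \<Rightarrow> nat \<Rightarrow> nat \<Rightarrow> nat \<Rightarrow> 'a"
    and Ci Co Hi Wi Ho Wo K N X :: nat
  assumes "N > 0" and "K > 0"
    and "Hi = Ho + K - 1" and "Wi = Wo + K - 1"
    and "X = nat \<lceil>real Wi / real N\<rceil>"
    and "\<And>co h w. co < Co \<Longrightarrow> h < Ho \<Longrightarrow> w < Wo \<Longrightarrow> Out co h w = dnn_conv Ci K I W co h w"
    and "\<And>ci co h kh. ci < Ci \<Longrightarrow> co < Co \<Longrightarrow> h < Ho \<Longrightarrow> kh < K \<Longrightarrow>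
           y ci co h kh = conv1d (X * N) K (fm_row Hi Wi I ci h kh) (rev_kernel_row K W co ci kh)"
  shows "\<forall>co<Co. \<forall>h<Ho. \<forall>w<Wo.
           Out co h w = (\<Sum>ci<Ci. \<Sum>kh<K. y ci co h kh (w + K - 1))"
proof (intro allI impI)
  fix co h w
  assume co: "co < Co" and h: "h < Ho" and w: "w < Wo"
  have "Wi \<le> X * N"
    unfolding assms(5) using \<open>N > 0\<close> by (rule le_nat_ceiling_divide_mult)
  \<comment> \<open>Since w + 1 \<le> Wo, the window ends by Wo + K - 1 = Wi, hence within the
    padded length.\<close>
  then have len: "w + K \<le> X * N"
    using w assms(4) by linarith
  have row: "y ci co h kh (w + K - 1) = (\<Sum>kw<K. I ci (h + kh) (w + kw) * W co ci kh kw)"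
    if "ci < Ci" "kh < K" for ci kh
  proof -
    have "y ci co h kh (w + K - 1)
        = (\<Sum>kw<K. fm_row Hi Wi I ci h kh (w + kw) * W co ci kh kw)"
      using that co h conv1d_reversed_eq_correlation[OF len]
      by (simp add: assms(7) rev_kernel_row_def [abs_def])
    \<comment> \<open>Here h < Ho \<le> Hi, and w + kw < Wi for kw < K, so the zero branch of
      \<open>fm_row\<close> is never taken.\<close>
    also have "\<dots> = (\<Sum>kw<K. I ci (h + kh) (w + kw) * W co ci kh kw)"
      using h w assms(3,4) by (intro sum.cong) (auto simp: fm_row_def)
    finally show ?thesis .
  qed
  show "Out co h w = (\<Sum>ci<Ci. \<Sum>kh<K. y ci co h kh (w + K - 1))"
    using co h w by (simp add: assms(6) dnn_conv_def row del: One_nat_def)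
qed

end
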